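(* Let $A$ be a Banach algebra. If every continuous cyclic Jordan derivation from $A$ into $A^*$ is an inner derivation, then $A$ is a zero Lie product determined Banach algebra.
   Context: Banach algebras are complex; $A^*$ is the dual space of $A$, which is a Banach $A$-bimodule via $(a\cdot f)(c)=f(ca)$, $(f\cdot a)(c)=f(ac)$ for $a,c\in A$, $f\in A^*$. Write $a\circ b=ab+ba$ for $a,b\in A$, and $a\circ f=f\circ a=a\cdot f+f\cdot a$ for $a\in A$, $f\in A^*$. A linear map $\delta\colon A\to A^*$ is a Jordan derivation if $\delta(a\circ b)=\delta(a)\circ b+a\circ\delta(b)$ for all $a,b\in A$. It is cyclic if $\delta(a)(b)=-\delta(b)(a)$ for all $a,b\in A$. It is an inner derivation if there is $\omega\in A^*$ with $\delta(a)=a\cdot\omega-\omega\cdot a$ for all $a\in A$. $A$ is a zero Lie product determined Banach algebra if for every continuous bilinear functional $\varphi\colon A\times A\to\mathbb{C}$ satisfying $\varphi(a,b)=0$ whenever $a,b\in A$ and $ab=ba$, there exists $\omega\in A^*$ such that $\varphi(a,b)=\omega(ab-ba)$ for all $a,b\in A$. *)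

theory Defs
  imports "HOL-Analysis.Analysis"
begin

text \<open>
  Complex Banach algebras, not assumed unital. The library's \<open>real_normed_algebra\<close> and
  \<open>banach\<close> supply the submultiplicative complete norm; a compatible complex scalar
  multiplication is added.
\<close>

class complex_banach_algebra = real_normed_algebra + banach +
  fixes scaleC :: "complex \<Rightarrow> 'a \<Rightarrow> 'a"  (infixr "*\<^sub>C" 75)
  assumes scaleC_add_right: "c *\<^sub>C (x + y) = c *\<^sub>C x + c *\<^sub>C y"
    and scaleC_add_left: "(c + d) *\<^sub>C x = c *\<^sub>C x + d *\<^sub>C x"
    and scaleC_scaleC: "c *\<^sub>C (d *\<^sub>C x) = (c * d) *\<^sub>C x"
    and scaleC_of_real: "complex_of_real r *\<^sub>C x = r *\<^sub>R x"
    and mult_scaleC_left: "(c *\<^sub>C x) * y = c *\<^sub>C (x * y)"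
    and mult_scaleC_right: "x * (c *\<^sub>C y) = c *\<^sub>C (x * y)"
    and norm_scaleC: "norm (c *\<^sub>C x) = cmod c * norm x"

lemma vector_space_scaleC:
  "vector_space (scaleC :: complex \<Rightarrow> 'a::complex_banach_algebra \<Rightarrow> 'a)"
proof
  fix x :: 'a
  show "1 *\<^sub>C x = x"
    using scaleC_of_real[of 1 x] by simp
qed (simp_all add: scaleC_add_right scaleC_add_left scaleC_scaleC)

lemma vector_space_complex: "vector_space ((*) :: complex \<Rightarrow> complex \<Rightarrow> complex)"
  by standard (simp_all add: algebra_simps)

text \<open>
  The type \<open>'a \<Rightarrow>\<^sub>L complex\<close> consists of the bounded \<^emph>\<open>real\<close>-linear maps, with the
  operator norm; the dual space is its subset of complex-linear maps, with the same norm.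
\<close>

definition dual_space :: "('a::complex_banach_algebra \<Rightarrow>\<^sub>L complex) set" where
  "dual_space = {f. Vector_Spaces.linear scaleC (*) (blinfun_apply f)}"

lift_definition dual_scale ::
    "complex \<Rightarrow> ('a::complex_banach_algebra \<Rightarrow>\<^sub>L complex) \<Rightarrow> 'a \<Rightarrow>\<^sub>L complex"
  is "\<lambda>c f x. c * f x"
  by (rule bounded_linear_const_mult)

lift_definition left_act ::
    "'a::complex_banach_algebra \<Rightarrow> ('a \<Rightarrow>\<^sub>L complex) \<Rightarrow> 'a \<Rightarrow>\<^sub>L complex"
  is "\<lambda>a f c. f (c * a)"
  by (rule bounded_linear_compose[OF _ bounded_linear_mult_left])

lift_definition right_act ::
    "('a::complex_banach_algebra \<Rightarrow>\<^sub>L complex) \<Rightarrow> 'a \<Rightarrow> 'a \<Rightarrow>\<^sub>L complex"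
  is "\<lambda>f a c. f (a * c)"
  by (rule bounded_linear_compose[OF _ bounded_linear_mult_right])

lemma vector_space_dual_scale:
  "vector_space (dual_scale :: complex \<Rightarrow> ('a::complex_banach_algebra \<Rightarrow>\<^sub>L complex) \<Rightarrow> _)"
  by standard (transfer; simp add: algebra_simps)+

lemma dual_space_iff:
  "f \<in> dual_space \<longleftrightarrow> (\<forall>c x. blinfun_apply f (c *\<^sub>C x) = c * blinfun_apply f x)"
  unfolding dual_space_def
  by (auto simp: Vector_Spaces.linear_iff vector_space_scaleC vector_space_complex
      blinfun.add_right)

lemma dual_scale_in_dual_space: "f \<in> dual_space \<Longrightarrow> dual_scale c f \<in> dual_space"
  by (simp add: dual_space_iff dual_scale.rep_eq)

lemma left_act_in_dual_space: "f \<in> dual_space \<Longrightarrow> left_act a f \<in> dual_space"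
  by (simp add: dual_space_iff left_act.rep_eq mult_scaleC_left)

lemma right_act_in_dual_space: "f \<in> dual_space \<Longrightarrow> right_act f a \<in> dual_space"
  by (simp add: dual_space_iff right_act.rep_eq mult_scaleC_right)

definition jordan_product :: "'a::complex_banach_algebra \<Rightarrow> 'a \<Rightarrow> 'a" where
  "jordan_product a b = a * b + b * a"

definition jordan_act ::
    "'a::complex_banach_algebra \<Rightarrow> ('a \<Rightarrow>\<^sub>L complex) \<Rightarrow> 'a \<Rightarrow>\<^sub>L complex" where
  "jordan_act a f = left_act a f + right_act f a"

text \<open>
  As \<open>f \<circ> a = a \<circ> f\<close> for an algebra element \<open>a\<close> and a functional \<open>f\<close>, both are written
  \<open>jordan_act a f\<close>.
\<close>

definition jordan_derivation ::
    "('a::complex_banach_algebra \<Rightarrow> ('a \<Rightarrow>\<^sub>L complex)) \<Rightarrow> bool" where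
  "jordan_derivation \<delta> \<longleftrightarrow>
     range \<delta> \<subseteq> dual_space \<and>
     Vector_Spaces.linear scaleC dual_scale \<delta> \<and>
     (\<forall>a b. \<delta> (jordan_product a b) = jordan_act b (\<delta> a) + jordan_act a (\<delta> b))"

definition cyclic :: "('a::complex_banach_algebra \<Rightarrow> ('a \<Rightarrow>\<^sub>L complex)) \<Rightarrow> bool" where
  "cyclic \<delta> \<longleftrightarrow> (\<forall>a b. blinfun_apply (\<delta> a) b = - blinfun_apply (\<delta> b) a)"

definition inner_derivation ::
    "('a::complex_banach_algebra \<Rightarrow> ('a \<Rightarrow>\<^sub>L complex)) \<Rightarrow> bool" where
  "inner_derivation \<delta> \<longleftrightarrow>
     (\<exists>\<omega>\<in>dual_space. \<forall>a. \<delta> a = left_act a \<omega> - right_act \<omega> a)"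

definition continuous_bilinear_functional ::
    "('a::complex_banach_algebra \<Rightarrow> 'a \<Rightarrow> complex) \<Rightarrow> bool" where
  "continuous_bilinear_functional \<phi> \<longleftrightarrow>
     (\<forall>a. Vector_Spaces.linear scaleC (*) (\<lambda>b. \<phi> a b)) \<and>
     (\<forall>b. Vector_Spaces.linear scaleC (*) (\<lambda>a. \<phi> a b)) \<and>
     continuous_on UNIV (\<lambda>(a, b). \<phi> a b)"

definition zero_Lie_product_determined :: "'a::complex_banach_algebra itself \<Rightarrow> bool" where
  "zero_Lie_product_determined _ \<longleftrightarrow>
     (\<forall>\<phi> :: 'a \<Rightarrow> 'a \<Rightarrow> complex.
        continuous_bilinear_functional \<phi> \<and> (\<forall>a b. a * b = b * a \<longrightarrow> \<phi> a b = 0) \<longrightarrow>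
        (\<exists>\<omega>\<in>dual_space. \<forall>a b. \<phi> a b = blinfun_apply \<omega> (a * b - b * a)))"

end

theory Submission
  imports Defs
begin

text \<open>
  The idea is to read a bilinear functional \<open>\<phi>\<close> that vanishes on commuting pairs as the map
  \<open>\<delta> b = \<phi>(\<cdot>, b)\<close> from the algebra into its dual.  Only two kinds of commuting pairs matter.
  Since \<open>a\<close> commutes with itself, \<open>\<phi>\<close> is alternating, which makes \<open>\<delta>\<close> cyclic.  Since \<open>a\<close>
  commutes with its square, the cubic form \<open>\<phi>(a, a\<^sup>2)\<close> vanishes, and its full polarization is
  \[ \<phi>(a, b \<circ> c) + \<phi>(b, a \<circ> c) + \<phi>(c, a \<circ> b) = 0. \]
  Moving the first two terms across with the alternating property turns this into the Jordan
  derivation identity for \<open>\<delta>\<close>, evaluated at \<open>c\<close>.  Joint continuity makes \<open>\<phi>\<close> bounded, so \<open>\<delta>\<close>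
  is norm continuous.  The hypothesis now yields \<open>\<omega>\<close> with \<open>\<delta> b = b \<cdot> \<omega> - \<omega> \<cdot> b\<close>, and evaluating
  at \<open>a\<close> gives \<open>\<phi>(a, b) = \<omega>(a b) - \<omega>(b a)\<close>.
\<close>

lemma continuous_bilinear_functionalD:
  assumes "continuous_bilinear_functional \<phi>"
  shows "\<phi> (a + a') b = \<phi> a b + \<phi> a' b"
    and "\<phi> a (b + b') = \<phi> a b + \<phi> a b'"
    and "\<phi> (z *\<^sub>C a) b = z * \<phi> a b"
    and "\<phi> a (z *\<^sub>C b) = z * \<phi> a b"
  using assms
  by (auto simp: continuous_bilinear_functional_def Vector_Spaces.linear_iff)

lemma continuous_bilinear_functional_scaleR:
  assumes "continuous_bilinear_functional \<phi>"
  shows "\<phi> (r *\<^sub>R a) b = r *\<^sub>R \<phi> a b"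
    and "\<phi> a (r *\<^sub>R b) = r *\<^sub>R \<phi> a b"
  using continuous_bilinear_functionalD(3)[OF assms, of "complex_of_real r" a b]
    continuous_bilinear_functionalD(4)[OF assms, of a "complex_of_real r" b]
  by (simp_all add: scaleC_of_real scaleR_conv_of_real)

text \<open>
  Joint continuity at the origin bounds \<open>\<phi>\<close> by \<open>1\<close> on a product of two small balls; rescaling
  both arguments separately turns this into a bound by the product of the norms.
\<close>

lemma continuous_bilinear_functional_bounded_bilinear:
  assumes "continuous_bilinear_functional \<phi>"
  shows "bounded_bilinear \<phi>"
proof
  note add = continuous_bilinear_functionalD(1,2)[OF assms]
  note scale = continuous_bilinear_functional_scaleR[OF assms]
  fix r a a' b b'
  show "\<phi> (a + a') b = \<phi> a b + \<phi> a' b" "\<phi> a (b + b') = \<phi> a b + \<phi> a b'"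
    "\<phi> (r *\<^sub>R a) b = r *\<^sub>R \<phi> a b" "\<phi> a (r *\<^sub>R b) = r *\<^sub>R \<phi> a b"
    by (rule add scale)+
  have zero: "\<phi> 0 b = 0" "\<phi> a 0 = 0" for a b
    using scale(1)[of 0 0 b] scale(2)[of a 0 0] by simp_all
  have "continuous_on UNIV (\<lambda>(a, b). \<phi> a b)"
    using assms by (simp add: continuous_bilinear_functional_def)
  then obtain d where "d > 0"
    and d: "\<And>x. dist x (0, 0) < d \<Longrightarrow> dist (case x of (a, b) \<Rightarrow> \<phi> a b) (\<phi> 0 0) < 1"
    unfolding continuous_on_iff by (metis UNIV_I case_prod_conv zero_less_one)
  have small: "norm (\<phi> a b) \<le> 1" if "norm a \<le> d / 3" "norm b \<le> d / 3" for a b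
  proof -
    have "norm (a, b) \<le> norm a + norm b"
      by (simp add: norm_Pair sqrt_sum_squares_le_sum)
    with that \<open>d > 0\<close> have "dist (a, b) (0, 0) < d"
      by (simp add: dist_norm)
    from d[OF this] show ?thesis
      by (simp add: zero)
  qed
  show "\<exists>K. \<forall>a b. norm (\<phi> a b) \<le> norm a * norm b * K"
  proof (intro exI allI)
    fix a b
    show "norm (\<phi> a b) \<le> norm a * norm b * (9 / d\<^sup>2)"
    proof (cases "a = 0 \<or> b = 0")
      case True
      then show ?thesis
        by (auto simp: zero)
    next
      case False
      define s where "s = d / 3 / norm a"
      define t where "t = d / 3 / norm b"
      have "s > 0" "t > 0"
        using False \<open>d > 0\<close> by (simp_all add: s_def t_def)
      have "norm (\<phi> (s *\<^sub>R a) (t *\<^sub>R b)) \<le> 1"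
        using False \<open>d > 0\<close> by (intro small) (simp_all add: s_def t_def)
      then have "t * s * norm (\<phi> a b) \<le> 1"
        using \<open>s > 0\<close> \<open>t > 0\<close> by (simp add: scale)
      then have "norm (\<phi> a b) \<le> 1 / (t * s)"
        using \<open>s > 0\<close> \<open>t > 0\<close> by (simp add: field_simps)
      also have "\<dots> = norm a * norm b * (9 / d\<^sup>2)"
        using False \<open>d > 0\<close> by (simp add: s_def t_def power2_eq_square field_simps)
      finally show ?thesis .
    qed
  qed
qed

lemma alternating_imp_antisymmetric:
  assumes "continuous_bilinear_functional \<phi>" and "\<And>a. \<phi> a a = 0"
  shows "\<phi> a b = - \<phi> b a"
proof -
  have "\<phi> a b + \<phi> b a = \<phi> (a + b) (a + b)"
    unfolding continuous_bilinear_functionalD(1,2)[OF assms(1)] by (simp add: assms(2))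
  then show ?thesis
    by (simp add: assms(2) eq_neg_iff_add_eq_0)
qed

text \<open>
  The polarization of \<open>P(x) = \<phi>(x, x\<^sup>2)\<close> is extracted by inclusion-exclusion over the sums of
  nonempty subfamilies of \<open>a\<close>, \<open>b\<close>, \<open>c\<close>: in the alternating sum of the values of \<open>P\<close>, only the
  terms involving each of the three elements survive.
\<close>

lemma polarize_vanishing_on_squares:
  assumes "continuous_bilinear_functional \<phi>" and "\<And>a. \<phi> a (a * a) = 0"
  shows "\<phi> a (jordan_product b c) + \<phi> b (jordan_product a c) + \<phi> c (jordan_product a b) = 0"
proof -
  define P where "P x = \<phi> x (x * x)" for x
  have "\<phi> a (jordan_product b c) + \<phi> b (jordan_product a c) + \<phi> c (jordan_product a b)
      = P (a + b + c) - P (a + b) - P (a + c) - P (b + c) + P a + P b + P c"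
    unfolding P_def jordan_product_def distrib_left distrib_right
      continuous_bilinear_functionalD(1,2)[OF assms(1)]
    by (simp add: algebra_simps)
  then show ?thesis
    by (simp add: P_def assms(2))
qed

theorem theorem3p1:
  assumes "\<And>\<delta> :: 'a::complex_banach_algebra \<Rightarrow> ('a \<Rightarrow>\<^sub>L complex).
             jordan_derivation \<delta> \<Longrightarrow> cyclic \<delta> \<Longrightarrow> continuous_on UNIV \<delta> \<Longrightarrow> inner_derivation \<delta>"
  shows "zero_Lie_product_determined TYPE('a)"
  unfolding zero_Lie_product_determined_def
proof (intro allI impI, elim conjE)
  fix \<phi> :: "'a \<Rightarrow> 'a \<Rightarrow> complex"
  assume \<phi>: "continuous_bilinear_functional \<phi>"
    and commuting: "\<forall>a b. a * b = b * a \<longrightarrow> \<phi> a b = 0"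
  note bilinear = continuous_bilinear_functionalD[OF \<phi>]
  interpret bounded_bilinear \<phi>
    using \<phi> by (rule continuous_bilinear_functional_bounded_bilinear)
  have antisymmetric: "\<phi> a b = - \<phi> b a" for a b
    using \<phi> by (rule alternating_imp_antisymmetric) (simp add: commuting)
  have polarized:
    "\<phi> a (jordan_product b c) + \<phi> b (jordan_product a c) + \<phi> c (jordan_product a b) = 0" for a b c
    using \<phi> by (rule polarize_vanishing_on_squares) (simp add: commuting mult.assoc)
  define \<delta> where "\<delta> = prod_left"
  have apply_\<delta>: "blinfun_apply (\<delta> b) a = \<phi> a b" for a b
    by (simp add: \<delta>_def prod_left.rep_eq)
  have "jordan_derivation \<delta>"
    unfolding jordan_derivation_def
  proof (intro conjI allI)
    show "range \<delta> \<subseteq> dual_space"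
      by (auto simp: dual_space_iff apply_\<delta> bilinear)
    show "Vector_Spaces.linear scaleC dual_scale \<delta>"
      by (auto simp: Vector_Spaces.linear_iff vector_space_scaleC vector_space_dual_scale
          intro!: blinfun_eqI simp: apply_\<delta> bilinear dual_scale.rep_eq plus_blinfun.rep_eq)
    fix a b
    show "\<delta> (jordan_product a b) = jordan_act b (\<delta> a) + jordan_act a (\<delta> b)"
    proof (rule blinfun_eqI)
      fix c
      have "\<phi> c (jordan_product a b) = - \<phi> a (jordan_product b c) - \<phi> b (jordan_product a c)"
        using polarized[of a b c] by (simp add: algebra_simps eq_neg_iff_add_eq_0)
      also have "\<dots> = \<phi> (jordan_product b c) a + \<phi> (jordan_product a c) b"
        using antisymmetric[of a] antisymmetric[of b] by simp
      finally show "blinfun_apply (\<delta> (jordan_product a b)) c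
          = blinfun_apply (jordan_act b (\<delta> a) + jordan_act a (\<delta> b)) c"
        by (simp add: apply_\<delta> jordan_act_def plus_blinfun.rep_eq left_act.rep_eq
            right_act.rep_eq jordan_product_def bilinear)
    qed
  qed
  moreover have "cyclic \<delta>"
    unfolding cyclic_def apply_\<delta> using antisymmetric by blast
  moreover have "continuous_on UNIV \<delta>"
    unfolding \<delta>_def by (rule linear_continuous_on[OF bounded_linear_prod_left])
  ultimately have "inner_derivation \<delta>"
    by (rule assms)
  then obtain \<omega> where "\<omega> \<in> dual_space" and \<omega>: "\<And>b. \<delta> b = left_act b \<omega> - right_act \<omega> b"
    unfolding inner_derivation_def by blast
  have "\<phi> a b = blinfun_apply \<omega> (a * b - b * a)" for a b
    using apply_\<delta>[of b a]
    by (simp add: \<omega> minus_blinfun.rep_eq left_act.rep_eq right_act.rep_eq blinfun.diff_right)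
  with \<open>\<omega> \<in> dual_space\<close>
  show "\<exists>\<omega>\<in>dual_space. \<forall>a b. \<phi> a b = blinfun_apply \<omega> (a * b - b * a)"
    by blast
qed

end
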